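(* An ordered group $G$ is a $\mathbb{T}_N$-group if and only if it is isomorphic (as an ordered group) to a non-trivial ordered subgroup of $\mathbb{Q}$.
   Context: $\mathbb{Q}$ denotes the additive group of rational numbers with its usual order, with non-negative elements as positive cone; subgroups carry the induced order. An ordered group is a group with a positivity predicate $P$ containing the neutral element $1$, closed under products and conjugation, and such that $P(a)$ and $P(a^{-1})$ imply $a=1$. A $\mathbb{T}_N$-group is a set-based model of the geometric theory $\mathbb{T}_N$ over the signature of groups (neutral element $1$) extended with a unary predicate $P$ and a binary relation symbol $\neq$, whose axioms are those of groups together with: $\top\vdash P(1)$; $P(a)\wedge P(b)\vdash_{a,b}P(a\cdot b)$; $P(a)\vdash_{a,c}P(c^{-1}\cdot a\cdot c)$; $P(a)\wedge P(a^{-1})\vdash_a a=1$; $\top\vdash_a P(a)\vee P(a^{-1})$; $x\neq x\vdash_x\bot$; $\top\vdash_{x,y}(x\neq y)\vee(x=y)$; $\top\vdash\exists x(x\neq1)$; $P(x)\wedge P(y)\vdash_{x,y}\bigvee_{n,m\in\mathbb{N}_0}\exists z(P(z)\wedge x=z^n\wedge y=z^m)$, where $\mathbb{N}_0$ is the set of natural numbers including $0$. In set-based models the relation $\neq$ is the usual non-equality, so an ordered group is called a $\mathbb{T}_N$-group if, with $\neq$ interpreted as non-equality, it is a model of $\mathbb{T}_N$. *)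

theory Defs
  imports Complex_Main "HOL-Algebra.Group"
begin

record 'a ogroup = "'a monoid" +
  pos :: "'a \<Rightarrow> bool"

text \<open>
  As with the operations of a group record, only the values of \<open>pos\<close> on the carrier matter.
  The positive cone is not required to be total.
\<close>
locale ordered_group = group G for G :: "('a, 'm) ogroup_scheme" (structure) +
  assumes pos_one: "pos G \<one>"
    and pos_mult: "\<lbrakk>a \<in> carrier G; b \<in> carrier G; pos G a; pos G b\<rbrakk> \<Longrightarrow> pos G (a \<otimes> b)"
    and pos_conj: "\<lbrakk>a \<in> carrier G; c \<in> carrier G; pos G a\<rbrakk> \<Longrightarrow> pos G (inv c \<otimes> a \<otimes> c)"
    and pos_antisym: "\<lbrakk>a \<in> carrier G; pos G a; pos G (inv a)\<rbrakk> \<Longrightarrow> a = \<one>"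

definition ogroup_iso :: "('a, 'm) ogroup_scheme \<Rightarrow> ('b, 'n) ogroup_scheme \<Rightarrow> ('a \<Rightarrow> 'b) set"
  where "ogroup_iso G K =
    {h. h \<in> iso G K \<and> (\<forall>a\<in>carrier G. pos G a \<longleftrightarrow> pos K (h a))}"

definition ogroup_isomorphic ::
    "('a, 'm) ogroup_scheme \<Rightarrow> ('b, 'n) ogroup_scheme \<Rightarrow> bool"
  where "ogroup_isomorphic G K \<longleftrightarrow> ogroup_iso G K \<noteq> {}"

text \<open>
  A set-based model of the theory consists of a structure \<open>G\<close> for the group operations and
  the predicate \<open>pos\<close>, together with an interpretation \<open>neq\<close> of the relation symbol for
  inequality, which is constrained by the axioms only.
\<close>
locale TN_model = group G for G :: "('a, 'm) ogroup_scheme" (structure) +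
  fixes neq :: "'a \<Rightarrow> 'a \<Rightarrow> bool"
  assumes P_one: "pos G \<one>"
    and P_mult: "\<lbrakk>a \<in> carrier G; b \<in> carrier G; pos G a; pos G b\<rbrakk> \<Longrightarrow> pos G (a \<otimes> b)"
    and P_conj: "\<lbrakk>a \<in> carrier G; c \<in> carrier G; pos G a\<rbrakk> \<Longrightarrow> pos G (inv c \<otimes> a \<otimes> c)"
    and P_antisym: "\<lbrakk>a \<in> carrier G; pos G a; pos G (inv a)\<rbrakk> \<Longrightarrow> a = \<one>"
    and P_total: "a \<in> carrier G \<Longrightarrow> pos G a \<or> pos G (inv a)"
    and neq_irrefl: "\<lbrakk>x \<in> carrier G; neq x x\<rbrakk> \<Longrightarrow> False"
    and neq_or_eq: "\<lbrakk>x \<in> carrier G; y \<in> carrier G\<rbrakk> \<Longrightarrow> neq x y \<or> x = y"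
    and nontrivial: "\<exists>x\<in>carrier G. neq x \<one>"
    and common_root: "\<lbrakk>x \<in> carrier G; y \<in> carrier G; pos G x; pos G y\<rbrakk> \<Longrightarrow>
      \<exists>(n::nat) (m::nat). \<exists>z\<in>carrier G. pos G z \<and> x = z [^] n \<and> y = z [^] m"

definition TN_group :: "('a, 'm) ogroup_scheme \<Rightarrow> bool"
  where "TN_group G \<longleftrightarrow> ordered_group G \<and> TN_model G (\<lambda>x y. x \<noteq> y)"

text \<open>
  The induced ordered group structure on a subgroup \<open>H\<close> is \<open>rat_ogroup\<lparr>carrier := H\<rparr>\<close>.
\<close>
definition rat_ogroup :: "rat ogroup"
  where "rat_ogroup = \<lparr>carrier = UNIV, mult = (+), one = 0, pos = (\<lambda>q. 0 \<le> q)\<rparr>"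

lemma group_rat_ogroup: "group rat_ogroup"
proof (rule groupI)
  show "\<exists>y\<in>carrier rat_ogroup. y \<otimes>\<^bsub>rat_ogroup\<^esub> x = \<one>\<^bsub>rat_ogroup\<^esub>"
    for x by (auto simp: rat_ogroup_def intro: exI[of _ "- x"])
qed (auto simp: rat_ogroup_def)

lemma inv_rat_ogroup: "inv\<^bsub>rat_ogroup\<^esub> q = - q"
  by (rule group.inv_equality[OF group_rat_ogroup]) (auto simp: rat_ogroup_def)

lemma ordered_group_rat_ogroup: "ordered_group rat_ogroup"
  by (intro ordered_group.intro ordered_group_axioms.intro group_rat_ogroup)
    (auto simp: inv_rat_ogroup, auto simp: rat_ogroup_def)

end

theory Submission
  imports Defs "HOL-Algebra.Generated_Groups"
begin

text \<open>
  Fix a positive \<open>e \<noteq> \<one>\<close> in a TN-group. A common root of \<open>g\<close> and \<open>e\<close> yields \<open>g\<^sup>m = e\<^sup>a\<close>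
  with \<open>m > 0\<close>; since the group is torsion-free, the slope \<open>a / m\<close> depends only on \<open>g\<close>, and since
  the group is abelian, \<open>g \<mapsto> a / m\<close> is an embedding into the rationals, which preserves and
  reflects the order. Conversely, the non-negative elements \<open>x = a / d\<close> and \<open>y = b / d\<close> of a
  subgroup of the rationals are multiples of \<open>gcd a b / d\<close>, which is an integral combination of
  \<open>x\<close> and \<open>y\<close>.
\<close>

section \<open>Powers and common roots in the rationals\<close>

lemma carrier_rat_ogroup [simp]: "carrier rat_ogroup = UNIV"
  and mult_rat_ogroup [simp]: "x \<otimes>\<^bsub>rat_ogroup\<^esub> y = x + y"
  and one_rat_ogroup [simp]: "\<one>\<^bsub>rat_ogroup\<^esub> = 0"
  and pos_rat_ogroup [simp]: "pos rat_ogroup x \<longleftrightarrow> 0 \<le> x"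
  by (simp_all add: rat_ogroup_def)

lemma nat_pow_rat_ogroup: "x [^]\<^bsub>rat_ogroup\<^esub> (n::nat) = of_nat n * x"
  by (induction n) (simp_all add: algebra_simps)

lemma int_pow_rat_ogroup: "x [^]\<^bsub>rat_ogroup\<^esub> (k::int) = of_int k * x"
  by (cases k rule: int_cases2)
    (simp_all add: group.int_pow_neg group_rat_ogroup int_pow_int nat_pow_rat_ogroup inv_rat_ogroup)

lemma (in group) int_pow_nat_pow:
  "x \<in> carrier G \<Longrightarrow> (x [^] (k::int)) [^] (n::nat) = x [^] (k * int n)"
  by (metis int_pow_int int_pow_pow)

text \<open>The coefficients \<open>u\<close> and \<open>v\<close> place the root \<open>z\<close>
  in every subgroup of the rationals that contains \<open>x\<close> and \<open>y\<close>.\<close>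

lemma nonneg_rat_common_root:
  fixes x y :: rat
  assumes "0 \<le> x" "0 \<le> y"
  obtains z :: rat and n m :: nat and u v :: int
  where "0 \<le> z" "x = of_nat n * z" "y = of_nat m * z" "z = of_int u * x + of_int v * y"
proof -
  obtain p q where x: "x = of_int p / of_int q" "0 < q"
    by (metis Rat_cases Fract_of_int_quotient)
  obtain r s where y: "y = of_int r / of_int s" "0 < s"
    by (metis Rat_cases Fract_of_int_quotient)
  define a where "a = p * s"
  define b where "b = r * q"
  define d :: rat where "d = of_int (q * s)"
  have d: "d > 0" using x y by (simp add: d_def)
  have xd: "x = of_int a / d" and yd: "y = of_int b / d"
    using x y by (simp_all add: a_def b_def d_def)
  have ab: "0 \<le> a" "0 \<le> b" using assms d by (simp_all add: xd yd zero_le_divide_iff)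
  define g where "g = gcd a b"
  obtain u v where uv: "u * a + v * b = g" unfolding g_def using bezout_int by blast
  have "g \<ge> 0" "g dvd a" "g dvd b" by (simp_all add: g_def)
  have nonneg: "\<exists>n::nat. c = g * int n" if "g dvd c" "0 \<le> c" for c
  \<comment> \<open>\<open>g\<close> vanishes when \<open>x = y = 0\<close>; then
    \<open>g dvd c\<close> forces \<open>c = 0\<close> and any \<open>n\<close> works.\<close>
  proof (cases "g = 0")
    case False
    with \<open>g \<ge> 0\<close> have "c div g \<ge> 0" using that by (simp add: pos_imp_zdiv_nonneg_iff)
    with that show ?thesis by (intro exI[of _ "nat (c div g)"]) simp
  qed (use that in simp)
  obtain n m :: nat where nm: "a = g * int n" "b = g * int m"
    using nonneg[OF \<open>g dvd a\<close> ab(1)] nonneg[OF \<open>g dvd b\<close> ab(2)] by blast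
  show thesis
  proof
    show "0 \<le> of_int g / d" using d \<open>g \<ge> 0\<close> by simp
    show "x = of_nat n * (of_int g / d)" "y = of_nat m * (of_int g / d)"
      by (simp_all add: xd yd nm)
    show "of_int g / d = of_int u * x + of_int v * y"
      by (simp add: xd yd add_divide_distrib flip: uv)
  qed
qed

section \<open>Ordered groups isomorphic to subgroups of the rationals\<close>

lemma TN_group_if_isomorphic:
  fixes G (structure)
  assumes "ordered_group G" "subgroup H rat_ogroup" "H \<noteq> {0}"
    and "ogroup_isomorphic G (rat_ogroup\<lparr>carrier := H\<rparr>)"
  shows "TN_group G"
proof -
  interpret ordered_group G by fact
  interpret H: subgroup H rat_ogroup by fact
  let ?K = "rat_ogroup\<lparr>carrier := H\<rparr>"
  obtain h where h: "h \<in> iso G ?K" and pos: "\<And>a. a \<in> carrier G \<Longrightarrow> pos G a \<longleftrightarrow> 0 \<le> h a"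
    using assms(4) by (auto simp: ogroup_isomorphic_def ogroup_iso_def)
  \<comment> \<open>\<open>?K\<close> differs from \<open>rat_ogroup\<close> only in its carrier, so
    \<open>h\<close> may be regarded as a map into all rationals, where powers and inverses are
    already computed.\<close>
  interpret h: group_hom G rat_ogroup h
    by (intro group_hom.intro group_hom_axioms.intro is_group group_rat_ogroup)
      (use h in \<open>auto simp: iso_def hom_def\<close>)
  have bij: "bij_betw h (carrier G) H" using h by (simp add: iso_def)
  have inj: "x = y" if "h x = h y" "x \<in> carrier G" "y \<in> carrier G" for x y
    using bij that by (auto simp: bij_betw_def dest: inj_onD)
  have surj: "\<exists>g\<in>carrier G. h g = q" if "q \<in> H" for q
    using bij that by (force simp: bij_betw_def)
  have in_H: "h x \<in> H" if "x \<in> carrier G" for x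
    using bij that by (auto simp: bij_betw_def)
  have h_one: "h \<one> = 0" using h.hom_one by simp
  have "TN_model G (\<lambda>x y. x \<noteq> y)"
  proof
    fix x assume "x \<in> carrier G"
    then show "pos G x \<or> pos G (inv x)"
      using pos by (auto simp: inv_rat_ogroup)
  next
    obtain q where "q \<in> H" "q \<noteq> 0" using assms(3) H.one_closed by auto
    then show "\<exists>x\<in>carrier G. x \<noteq> \<one>" using surj h_one by metis
  next
    fix x y assume xy: "x \<in> carrier G" "y \<in> carrier G" "pos G x" "pos G y"
    obtain z u v and n m :: nat
      where z: "0 \<le> z" "h x = of_nat n * z" "h y = of_nat m * z"
        "z = of_int u * h x + of_int v * h y"
      using nonneg_rat_common_root[of "h x" "h y"] xy pos by metis
    \<comment> \<open>Integer powers in the additive group are integer multiples, so both summands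
      of \<open>z\<close> lie in \<open>H\<close>.\<close>
    have "z \<in> H"
      using H.m_closed[of "of_int u * h x" "of_int v * h y"]
        group.subgroup_int_pow_closed[OF group_rat_ogroup assms(2) in_H, of x u]
        group.subgroup_int_pow_closed[OF group_rat_ogroup assms(2) in_H, of y v] xy
      by (simp add: int_pow_rat_ogroup z(4))
    then obtain g where g: "g \<in> carrier G" "h g = z" using surj by blast
    have "x = g [^] n" "y = g [^] m"
      using xy g z(2,3) by (auto intro!: inj simp: h.hom_nat_pow nat_pow_rat_ogroup)
    with g z(1) pos
    show "\<exists>(n::nat) (m::nat). \<exists>z\<in>carrier G. pos G z \<and> x = z [^] n \<and> y = z [^] m"
      by blast
  qed (auto intro: pos_one pos_mult pos_conj pos_antisym)
  with assms(1) show ?thesis by (simp add: TN_group_def)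
qed

section \<open>Torsion-freeness, commutativity and slopes\<close>

context ordered_group
begin

lemma pos_nat_pow: "\<lbrakk>x \<in> carrier G; pos G x\<rbrakk> \<Longrightarrow> pos G (x [^] (n::nat))"
  by (induction n) (auto intro: pos_one pos_mult)

text \<open>The inverse of \<open>x\<close> is the power \<open>x [^] (n - 1)\<close>, which is
  positive, so antisymmetry applies.\<close>

lemma pos_pow_eq_one:
  assumes "x \<in> carrier G" "pos G x" "x [^] (n::nat) = \<one>" "n > 0"
  shows "x = \<one>"
proof -
  obtain k where k: "n = Suc k" using assms(4) gr0_implies_Suc by blast
  have "inv x = x [^] k" using assms k by (intro inv_equality) auto
  then show ?thesis using assms pos_antisym pos_nat_pow by metis
qed

end

context TN_model
begin

lemma is_ordered_group: "ordered_group G"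
  by unfold_locales (fact P_one P_mult P_conj P_antisym)+

interpretation ordered_group G by (rule is_ordered_group)

text \<open>Totality reduces torsion-freeness to the positive case, applied to \<open>x\<close> or
  to its inverse.\<close>

lemma pow_eq_one:
  assumes "x \<in> carrier G" "x [^] (n::nat) = \<one>" "n > 0"
  shows "x = \<one>"
proof (cases "pos G x")
  case False
  then have "inv x = \<one>"
    using assms P_total[of x] pos_pow_eq_one[of "inv x" n] by (simp add: nat_pow_inv)
  then show ?thesis using assms by simp
qed (use assms pos_pow_eq_one in blast)

lemma int_pow_eq_one:
  assumes "x \<in> carrier G" "x [^] (k::int) = \<one>" "x \<noteq> \<one>"
  shows "k = 0"
  using assms pow_eq_one[of x]
  by (cases k rule: int_cases2) (auto simp: int_pow_neg int_pow_int)

lemma int_pow_inject: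
  assumes "x \<in> carrier G" "x [^] (k::int) = x [^] (l::int)" "x \<noteq> \<one>"
  shows "k = l"
proof -
  have "x [^] (k - l) = \<one>" using assms by (simp add: int_pow_diff)
  then show ?thesis using assms int_pow_eq_one by force
qed

lemma commute_inv:
  assumes "x \<in> carrier G" "y \<in> carrier G" "inv x \<otimes> y = y \<otimes> inv x"
  shows "x \<otimes> y = y \<otimes> x"
proof -
  have "x \<otimes> y = x \<otimes> (y \<otimes> inv x) \<otimes> x" using assms(1,2) by (simp add: m_assoc)
  also have "\<dots> = y \<otimes> x" using assms by (simp flip: assms(3) m_assoc)
  finally show ?thesis .
qed

text \<open>Two positive elements are powers of a common root, hence commute. Totality and
  \<open>commute_inv\<close> then remove positivity from one factor after the other.\<close>

lemma commute:
  assumes "x \<in> carrier G" "y \<in> carrier G"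
  shows "x \<otimes> y = y \<otimes> x"
proof -
  have both: "x \<otimes> y = y \<otimes> x"
    if "x \<in> carrier G" "y \<in> carrier G" "pos G x" "pos G y" for x y
    using common_root[OF that] by (auto simp: nat_pow_mult add.commute)
  have one: "x \<otimes> y = y \<otimes> x" if "x \<in> carrier G" "y \<in> carrier G" "pos G y" for x y
    using P_total[of x] both commute_inv that by (metis inv_closed)
  show ?thesis
    using P_total[of y] one commute_inv assms by (metis inv_closed)
qed

text \<open>A relation with fractions not necessarily in lowest terms: slopes can be added without
  cancelling, and existence and uniqueness become separate statements.\<close>

definition slope :: "'a \<Rightarrow> 'a \<Rightarrow> rat \<Rightarrow> bool"
  where "slope e g q \<longleftrightarrow>
    (\<exists>(a::int) (m::nat). m > 0 \<and> q = of_int a / of_nat m \<and> g [^] m = e [^] a)"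

lemma slope_exists:
  assumes "e \<in> carrier G" "pos G e" "e \<noteq> \<one>" "g \<in> carrier G"
  shows "\<exists>q. slope e g q"
proof -
  have *: "\<exists>(n::nat) (m::nat). m > 0 \<and> g [^] m = e [^] n" if g: "g \<in> carrier G" "pos G g" for g
  proof -
    obtain n m :: nat and z where "z \<in> carrier G" "g = z [^] n" "e = z [^] m"
      using common_root g assms by metis
    \<comment> \<open>Both \<open>g [^] m\<close> and \<open>e [^] n\<close> equal
      \<open>z [^] (n * m)\<close>, and \<open>m = 0\<close> would give
      \<open>e = \<one>\<close>.\<close>
    then show ?thesis using assms(3)
      by (intro exI[of _ n] exI[of _ m]) (auto simp: nat_pow_pow mult.commute intro: gr0I)
  qed
  show ?thesis
  proof (cases "pos G g")
    case True
    then show ?thesis using * assms by (metis slope_def int_pow_int)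
  next
    case False
    then obtain n m :: nat where "m > 0" "inv g [^] m = e [^] n"
      using * P_total assms by (metis inv_closed)
    then have "g [^] m = e [^] (- int n)"
      using assms by (metis int_pow_neg_int inv_inv nat_pow_closed nat_pow_inv)
    with \<open>m > 0\<close> show ?thesis unfolding slope_def by blast
  qed
qed

text \<open>Raising each equation to the denominator of the other expresses one power of
  \<open>g\<close> twice as a power of \<open>e\<close>; comparing exponents is
  cross-multiplication.\<close>

lemma slope_unique:
  assumes "e \<in> carrier G" "e \<noteq> \<one>" "g \<in> carrier G" "slope e g q" "slope e g r"
  shows "q = r"
proof -
  obtain a b :: int and m k :: nat
    where *: "m > 0" "q = of_int a / of_nat m" "g [^] m = e [^] a"
      "k > 0" "r = of_int b / of_nat k" "g [^] k = e [^] b"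
    using assms(4,5) unfolding slope_def by metis
  have "e [^] (a * int k) = (g [^] m) [^] k"
    using assms by (simp add: *(3) int_pow_nat_pow)
  also have "\<dots> = (g [^] k) [^] m" using assms by (simp add: nat_pow_pow mult.commute)
  also have "\<dots> = e [^] (b * int m)"
    using assms by (simp add: *(6) int_pow_nat_pow)
  finally have "a * int k = b * int m" using int_pow_inject assms by blast
  then have "(of_int a * of_nat k :: rat) = of_int b * of_nat m"
    by (metis of_int_mult of_int_of_nat_eq)
  then show ?thesis using * by (simp add: frac_eq_eq)
qed

text \<open>Over the common denominator \<open>m * k\<close> the numerators add up; commutativity
  distributes the power over the product.\<close>

lemma slope_mult:
  assumes "e \<in> carrier G" "g \<in> carrier G" "h \<in> carrier G" "slope e g q" "slope e h r"
  shows "slope e (g \<otimes> h) (q + r)"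
proof -
  obtain a b :: int and m k :: nat
    where *: "m > 0" "q = of_int a / of_nat m" "g [^] m = e [^] a"
      "k > 0" "r = of_int b / of_nat k" "h [^] k = e [^] b"
    using assms(4,5) unfolding slope_def by metis
  have "(g \<otimes> h) [^] (m * k) = (g [^] m) [^] k \<otimes> (h [^] k) [^] m"
    using assms commute
    by (simp add: pow_mult_distrib nat_pow_pow mult.commute)
  also have "\<dots> = e [^] (a * int k + b * int m)"
    using assms by (simp add: *(3,6) int_pow_nat_pow int_pow_mult)
  finally show ?thesis unfolding slope_def using *
    by (intro exI[of _ "a * int k + b * int m"] exI[of _ "m * k"]) (simp add: field_simps)
qed

lemma slope_zero:
  assumes "g \<in> carrier G" "slope e g 0"
  shows "g = \<one>"
  using assms pow_eq_one by (auto simp: slope_def)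

text \<open>With a negative numerator, \<open>g [^] m\<close> and its inverse would both be
  positive, so \<open>e\<close> would have a trivial power with non-zero exponent.\<close>

lemma slope_nonneg:
  assumes "e \<in> carrier G" "pos G e" "e \<noteq> \<one>" "g \<in> carrier G" "pos G g" "slope e g q"
  shows "0 \<le> q"
proof (rule ccontr)
  assume neg: "\<not> 0 \<le> q"
  obtain a m where *: "m > 0" "q = of_int a / of_nat m" "g [^] (m::nat) = e [^] (a::int)"
    using assms(6) unfolding slope_def by metis
  with neg have "a < 0" by (auto simp: divide_less_0_iff not_le)
  then obtain n where n: "a = - int n" "n > 0" by (metis neg_int_cases)
  have "inv (g [^] m) = e [^] n" using * n assms by (simp add: int_pow_neg int_pow_int)
  then have "g [^] m = \<one>" using assms pos_nat_pow P_antisym by (metis nat_pow_closed)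
  then show False using * \<open>a < 0\<close> int_pow_eq_one[of e a] assms by simp
qed

section \<open>The embedding into the rationals\<close>

lemma embeds_in_rat:
  assumes neq: "neq = (\<lambda>x y. x \<noteq> y)"
  shows "\<exists>H. subgroup H rat_ogroup \<and> H \<noteq> {0} \<and> ogroup_isomorphic G (rat_ogroup\<lparr>carrier := H\<rparr>)"
proof -
  \<comment> \<open>Some element differs from \<open>\<one>\<close>; either it or its inverse is
    positive.\<close>
  obtain e where e: "e \<in> carrier G" "pos G e" "e \<noteq> \<one>"
    using nontrivial P_total neq by (metis inv_closed inv_eq_1_iff)
  define h where "h g = (THE q. slope e g q)" for g
  have h: "slope e g (h g)" if "g \<in> carrier G" for g
    unfolding h_def using slope_exists[OF e that] slope_unique[OF e(1,3) that] by (metis theI)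
  interpret h: group_hom G rat_ogroup h
  proof (intro group_hom.intro group_hom_axioms.intro group_rat_ogroup homI)
    fix x y assume "x \<in> carrier G" "y \<in> carrier G"
    then show "h (x \<otimes> y) = h x \<otimes>\<^bsub>rat_ogroup\<^esub> h y"
      using slope_unique[OF e(1,3)] h slope_mult e(1) by (simp, metis m_closed)
  qed (simp_all add: is_group)
  have zero: "g = \<one>" if "g \<in> carrier G" "h g = 0" for g
    using h slope_zero that by metis
  \<comment> \<open>Slope zero only occurs at \<open>\<one>\<close>, so the kernel is
    trivial.\<close>
  have inj: "inj_on h (carrier G)" using zero by (simp add: h.inj_on_one_iff)
  have nonneg: "0 \<le> h g" if "g \<in> carrier G" "pos G g" for g
    using slope_nonneg e h that by blast
  have pos: "pos G g \<longleftrightarrow> 0 \<le> h g" if g: "g \<in> carrier G" for g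
  proof
    assume "0 \<le> h g"
    show "pos G g"
    proof (rule ccontr)
      assume "\<not> pos G g"
      \<comment> \<open>By totality \<open>inv g\<close> is positive, so \<open>h g\<close> is both
        non-negative and non-positive. Then \<open>g = \<one>\<close>, which is positive after
        all.\<close>
      then have "0 \<le> h (inv g)" using P_total nonneg g by (metis inv_closed)
      with \<open>0 \<le> h g\<close> g have "h g = 0" by (simp add: inv_rat_ogroup)
      with \<open>\<not> pos G g\<close> zero g P_one show False by blast
    qed
  qed (use nonneg g in blast)
  let ?H = "h ` carrier G"
  have "h \<in> ogroup_iso G (rat_ogroup\<lparr>carrier := ?H\<rparr>)"
    using inj pos by (auto simp: ogroup_iso_def iso_def hom_def bij_betw_def)
  moreover have "?H \<noteq> {0}" using e zero by blast
  ultimately show ?thesis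
    using h.img_is_subgroup by (auto simp: ogroup_isomorphic_def)
qed

end

theorem theorem4p8:
  fixes G :: "('a, 'm) ogroup_scheme"
  assumes "ordered_group G"
  shows "TN_group G \<longleftrightarrow>
    (\<exists>H. subgroup H rat_ogroup \<and> H \<noteq> {\<one>\<^bsub>rat_ogroup\<^esub>} \<and>
         ogroup_isomorphic G (rat_ogroup\<lparr>carrier := H\<rparr>))"
proof
  assume "TN_group G"
  then interpret TN_model G "\<lambda>x y. x \<noteq> y" by (simp add: TN_group_def)
  show "\<exists>H. subgroup H rat_ogroup \<and> H \<noteq> {\<one>\<^bsub>rat_ogroup\<^esub>} \<and>
      ogroup_isomorphic G (rat_ogroup\<lparr>carrier := H\<rparr>)"
    using embeds_in_rat[OF refl] by simp
next
  assume "\<exists>H. subgroup H rat_ogroup \<and> H \<noteq> {\<one>\<^bsub>rat_ogroup\<^esub>} \<and>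
      ogroup_isomorphic G (rat_ogroup\<lparr>carrier := H\<rparr>)"
  then show "TN_group G" using TN_group_if_isomorphic[OF assms] by auto
qed

end
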